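(* Let $a>b>0$ and $\gamma=\frac{ab}{b-a}$ (so that $\gamma<-b$). Let $\hat p_4$ be a real polynomial of degree $4$ for which there is a real polynomial $\hat q_2$ of degree $2$ with $$\hat p_4^2(s)-s\left(s-\frac1a\right)\left(s+\frac1b\right)\left(s-\frac1\gamma\right)\hat q_2^2(s)=1.$$ Then $\hat p_4(s)$ equals, up to a constant multiplier, $$T_2\big(2abs^2+2(a-b)s-1\big),$$ where $T_2(x)=2x^2-1$ is the second Chebyshev polynomial.
   Context: The value of $\gamma$ is the one with $\gamma<-b$ for which billiard trajectories within the ellipse $\frac{x^2}{a}+\frac{y^2}{b}=1$ in the Minkowski plane with caustic $\frac{x^2}{a-\gamma}+\frac{y^2}{b+\gamma}=1$ (a hyperbola) are $4$-periodic. *)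

theory Defs
  imports Complex_Main "HOL-Computational_Algebra.Polynomial"
begin

fun chebyshev_T :: "nat \<Rightarrow> real poly" where
  "chebyshev_T 0 = 1"
| "chebyshev_T (Suc 0) = [:0, 1:]"
| "chebyshev_T (Suc (Suc n)) = [:0, 2:] * chebyshev_T (Suc n) - chebyshev_T n"

lemma chebyshev_T_2: "chebyshev_T 2 = [:-1, 0, 2:]"
  by (simp add: numeral_2_eq_2 one_pCons)

lemma poly_chebyshev_T_2: "poly (chebyshev_T 2) x = 2 * x\<^sup>2 - 1"
  by (simp add: chebyshev_T_2 power2_eq_square algebra_simps)

end

theory Submission
  imports Defs
begin

text \<open>
  Put \<open>h = 2abs\<^sup>2 + 2(a-b)s - 1\<close>, \<open>D = s(s-1/a)(s+1/b)(s-1/\<gamma>)\<close> and \<open>k = 2ab\<close>. Since \<open>1/\<gamma> = 1/a - 1/b\<close>,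
  \<open>h + 1 = k s(s-1/\<gamma>)\<close> and \<open>h - 1 = k (s-1/a)(s+1/b)\<close>, so \<open>(h, k)\<close> solves the Pell equation
  \<open>x\<^sup>2 - D y\<^sup>2 = 1\<close>. Given another solution \<open>(p, q)\<close>, the polynomials \<open>qh - kp\<close> and \<open>qh + kp\<close> have
  sum \<open>2qh\<close> and product \<open>q\<^sup>2 - k\<^sup>2\<close>, both of degree 4, so one of them is a constant \<open>c\<close>. Eliminating
  \<open>p\<close> leaves \<open>q(q - 2ch) = k\<^sup>2 - c\<^sup>2\<close>, which forces \<open>q = 2ch\<close> and hence \<open>p = \<plusminus>(c/k)(2h\<^sup>2 - 1)\<close>.
\<close>

text \<open>Isolates one of the two cases, so that the other follows from it by replacing
  \<open>p\<close> with \<open>- p\<close>.\<close>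

lemma pell_eq_second_multiple_aux:
  fixes p q h D :: "'a :: field_char_0 poly"
  assumes pell: "p\<^sup>2 - D * q\<^sup>2 = 1" and base: "h\<^sup>2 - D * [:k:]\<^sup>2 = 1"
    and deg: "degree q = degree h" "degree h > 0"
    and const: "degree (q * h - [:k:] * p) = 0"
  shows "\<exists>c. c \<noteq> 0 \<and> p = smult c (2 * h\<^sup>2 - 1)"
proof -
  obtain c where c: "q * h - [:k:] * p = [:c:]"
    using const degree_eq_zeroE by blast
  have prod: "(q * h - [:k:] * p) * (q * h + [:k:] * p) = q\<^sup>2 - [:k:]\<^sup>2"
    using pell base by algebra
  have "q * (q - 2 * [:c:] * h) = [:k:]\<^sup>2 - [:c:]\<^sup>2"
    using prod c by algebra
  also have "\<dots> = [:k\<^sup>2 - c\<^sup>2:]"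
    by (simp add: power2_eq_square)
  finally have factor: "q * (q - 2 * [:c:] * h) = [:k\<^sup>2 - c\<^sup>2:]" .
  have "q \<noteq> 0" using deg by auto
  \<comment> \<open>A nonzero cofactor would give the left side of \<open>factor\<close> positive
    degree, but the right side is constant.\<close>
  have "q - 2 * [:c:] * h = 0"
  proof (rule ccontr)
    assume "q - 2 * [:c:] * h \<noteq> 0"
    with \<open>q \<noteq> 0\<close> have "degree (q * (q - 2 * [:c:] * h)) \<ge> degree q"
      by (simp add: degree_mult_eq)
    with factor deg show False by simp
  qed
  hence q: "q = 2 * [:c:] * h" by simp
  have "c \<noteq> 0" using q \<open>q \<noteq> 0\<close> by auto
  \<comment> \<open>This excludes \<open>k = 0\<close>, allowing division by \<open>k\<close>, and
    shows that the multiplier \<open>c / k\<close> is a sign.\<close>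
  have "k\<^sup>2 = c\<^sup>2" using factor \<open>q - 2 * [:c:] * h = 0\<close> by simp
  with \<open>c \<noteq> 0\<close> have "k \<noteq> 0" by auto
  have "[:k:] * p = q * h - (q * h - [:k:] * p)"
    by (simp only: diff_diff_eq2 add_diff_cancel_left')
  also have "\<dots> = q * h - [:c:] * 1" unfolding c by (simp only: mult_1_right)
  also have "\<dots> = [:c:] * (2 * h\<^sup>2 - 1)"
    unfolding q by (simp only: right_diff_distrib power2_eq_square ac_simps)
  finally have "[:k:] * p = [:c:] * (2 * h\<^sup>2 - 1)" .
  hence "smult k p = smult c (2 * h\<^sup>2 - 1)" by simp
  hence "smult (1 / k) (smult k p) = smult (c / k) (2 * h\<^sup>2 - 1)"
    by simp
  with \<open>k \<noteq> 0\<close> \<open>c \<noteq> 0\<close> show ?thesis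
    by (intro exI[of _ "c / k"]) simp
qed

lemma pell_eq_second_multiple:
  fixes p q h D :: "'a :: field_char_0 poly"
  assumes pell: "p\<^sup>2 - D * q\<^sup>2 = 1" and base: "h\<^sup>2 - D * [:k:]\<^sup>2 = 1"
    and deg: "degree q = degree h" "degree h > 0"
  shows "\<exists>c. c \<noteq> 0 \<and> p = smult c (2 * h\<^sup>2 - 1)"
proof -
  \<comment> \<open>Formally, the coefficients of \<open>sqrt D\<close> in
    \<open>(p + q * sqrt D) * (h - k * sqrt D)\<close> and in
    \<open>(p + q * sqrt D) * (h + k * sqrt D)\<close>.\<close>
  define u v where "u = q * h - [:k:] * p" and "v = q * h + [:k:] * p"
  have nz: "q \<noteq> 0" "h \<noteq> 0" using deg by auto
  have prod: "u * v = q\<^sup>2 - [:k:]\<^sup>2"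
    using pell base unfolding u_def v_def by algebra
  have "degree ([:k:]\<^sup>2) < degree (q\<^sup>2)"
    using deg nz by (simp add: power2_eq_square degree_mult_eq)
  hence "degree (- [:k:]\<^sup>2 + q\<^sup>2) = degree (q\<^sup>2)"
    by (intro degree_add_eq_right) simp
  also have "\<dots> = 2 * degree h"
    using nz deg by (simp add: degree_power_eq)
  finally have deg_prod: "degree (u * v) = 2 * degree h"
    by (simp add: prod)
  hence "u * v \<noteq> 0" using deg by auto
  hence deg_uv: "degree u + degree v = 2 * degree h"
    using deg_prod by (simp add: degree_mult_eq)
  have "u + v = 2 * (q * h)" by (simp add: u_def v_def)
  hence "u + v = smult 2 (q * h)" by (simp add: numeral_poly)
  hence "degree (u + v) = 2 * degree h"
    using nz deg by (simp add: degree_mult_eq)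
  hence "2 * degree h \<le> max (degree u) (degree v)"
    by (metis degree_add_le_max)
  \<comment> \<open>The larger degree already exhausts the sum \<open>2 * degree h\<close>.\<close>
  with deg_uv consider "degree u = 0" | "degree v = 0" by linarith
  thus ?thesis
  proof cases
    case 1
    with pell_eq_second_multiple_aux[OF pell base deg] show ?thesis
      by (simp add: u_def)
  next
    case 2
    \<comment> \<open>The sign change of \<open>p\<close> preserves the Pell equation and swaps
      \<open>u\<close> and \<open>v\<close>.\<close>
    hence "degree (q * h - [:k:] * (- p)) = 0" by (simp add: v_def)
    with pell_eq_second_multiple_aux[of "- p" D q h k] pell base deg
    obtain c where "c \<noteq> 0" "- p = smult c (2 * h\<^sup>2 - 1)" by auto
    hence "p = smult (- c) (2 * h\<^sup>2 - 1)" by (metis minus_minus smult_minus_left)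
    with \<open>c \<noteq> 0\<close> show ?thesis by (intro exI[of _ "- c"]) simp
  qed
qed

theorem proposition8p5:
  fixes a b \<gamma> :: real and p q :: "real poly"
  assumes "a > b" and "b > 0"
    and "\<gamma> = a * b / (b - a)"
    and "degree p = 4" and "degree q = 2"
    and "p\<^sup>2 - [:0, 1:] * [:- (1 / a), 1:] * [:1 / b, 1:] * [:- (1 / \<gamma>), 1:] * q\<^sup>2 = 1"
  shows "\<gamma> < - b \<and>
    (\<exists>c. c \<noteq> 0 \<and> p = smult c (pcompose (chebyshev_T 2) [:-1, 2 * (a - b), 2 * a * b:]))"
proof
  \<comment> \<open>The two sides differ by \<open>b\<^sup>2\<close>.\<close>
  have "b * (a - b) < a * b" using assms(1,2) by (simp add: algebra_simps)
  hence "b < a * b / (a - b)" using assms(1) by (simp add: pos_less_divide_eq)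
  moreover have "\<gamma> = - (a * b / (a - b))"
    using minus_divide_right[of "a * b" "a - b"] by (simp add: assms(3))
  ultimately show "\<gamma> < - b" by simp
next
  define h where "h = [:-1, 2 * (a - b), 2 * a * b:]"
  define D where "D = [:0, 1:] * [:- (1 / a), 1:] * [:1 / b, 1:] * [:- (1 / \<gamma>), 1:]"
  have pos: "a > 0" "b > 0" using assms(1,2) by auto
  have \<gamma>: "1 / \<gamma> = (b - a) / (a * b)" by (simp add: assms(3))
  \<comment> \<open>The value of \<open>\<gamma>\<close> enters here: it makes the linear
    coefficient \<open>- 2 * a * b / \<gamma>\<close> equal to \<open>2 * (a - b)\<close>.\<close>
  have plus: "h + 1 = [:2 * a * b:] * ([:0, 1:] * [:- (1 / \<gamma>), 1:])"
    unfolding \<gamma> h_def one_pCons using pos by (simp add: field_simps)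
  have minus: "h - 1 = [:2 * a * b:] * ([:- (1 / a), 1:] * [:1 / b, 1:])"
    unfolding h_def one_pCons using pos by (simp add: field_simps)
  have "h\<^sup>2 - D * [:2 * a * b:]\<^sup>2 = 1"
    using plus minus unfolding D_def by algebra
  moreover have "degree h = 2" using pos by (simp add: h_def)
  moreover have "p\<^sup>2 - D * q\<^sup>2 = 1" using assms(6) by (simp add: D_def)
  ultimately obtain c where "c \<noteq> 0" "p = smult c (2 * h\<^sup>2 - 1)"
    using pell_eq_second_multiple[of p D q h "2 * a * b"] assms(5) by auto
  moreover have "pcompose (chebyshev_T 2) h = 2 * h\<^sup>2 - 1"
    by (rule poly_ext)
       (simp add: poly_pcompose poly_chebyshev_T_2)
  ultimately show "\<exists>c. c \<noteq> 0 \<and> p = smult c (pcompose (chebyshev_T 2) [:-1, 2 * (a - b), 2 * a * b:])"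
    unfolding h_def by metis
qed

end
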